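(* For all integers $n\ge1$ and all $1\le j\le n$, \[N(n,j)=F_{2n-2}-F_{2j-4}F_{2(n-j)-1},\] where $N(n,j)$ is the number of Boolean permutations $w\in\mathcal B_n$ such that position $j$ is a record of $w$.
   Context: $\mathcal B_n$ is the set of Boolean permutations in $S_n$: those that can be written as a product of simple transpositions $s_i=(i\ i{+}1)$ in which no $s_i$ appears more than once. Position $j$ is a record of $w$ (in one-line notation) if there is no $k<j$ with $w(k)>w(j)$. $F_m$ is the Fibonacci sequence ($F_0=0$, $F_1=F_2=1$, $F_{m+1}=F_m+F_{m-1}$), extended to negative indices by $F_{-m}=(-1)^{m+1}F_m$. *)

theory Defs
  imports "HOL-Number_Theory.Fib" "HOL-Combinatorics.Permutations"
begin

text \<open>
  The symmetric group \<open>S\<^sub>n\<close> is the set of all \<open>w\<close> with \<open>w permutes {1..n}\<close>; such a \<open>w\<close> is the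
  identity outside \<open>{1..n}\<close>, and its one-line notation is \<open>w 1, ..., w n\<close>.
\<close>

definition simple_transposition :: "nat \<Rightarrow> nat \<Rightarrow> nat" where
  "simple_transposition i = transpose i (i + 1)"

definition simple_product :: "nat list \<Rightarrow> nat \<Rightarrow> nat" where
  "simple_product xs = foldr (\<circ>) (map simple_transposition xs) id"

text \<open>The generators of \<open>S\<^sub>n\<close> are the simple transpositions with index in \<open>{1..<n}\<close>.\<close>

definition boolean_perms :: "nat \<Rightarrow> (nat \<Rightarrow> nat) set" where
  "boolean_perms n = {w. w permutes {1..n} \<and>
     (\<exists>xs. distinct xs \<and> set xs \<subseteq> {1..<n} \<and> w = simple_product xs)}"

definition is_record :: "(nat \<Rightarrow> nat) \<Rightarrow> nat \<Rightarrow> bool" where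
  "is_record w j \<longleftrightarrow> \<not> (\<exists>k. 1 \<le> k \<and> k < j \<and> w k > w j)"

definition fib_int :: "int \<Rightarrow> int" where
  "fib_int m = (if m \<ge> 0 then int (fib (nat m))
                else (-1) ^ (nat (- m) + 1) * int (fib (nat (- m))))"

definition num_boolean_records :: "nat \<Rightarrow> nat \<Rightarrow> nat" where
  "num_boolean_records n j = card {w \<in> boolean_perms n. is_record w j}"

end

theory Submission
  imports Defs
begin

text \<open>
  Let \<open>s\<close> be the last generator of \<open>S\<^bsub>n+2\<^esub>\<close>. A Boolean permutation of \<open>{1..n+2}\<close> is \<open>u\<close>, \<open>u \<circ> s\<close> or
  \<open>s \<circ> u\<close> with \<open>u\<close> Boolean on \<open>{1..n+1}\<close>; the only coincidences are \<open>u \<circ> s = s \<circ> u\<close> for \<open>u\<close> Boolean on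
  \<open>{1..n}\<close>. Right multiplication by \<open>s\<close> swaps the last two positions and left multiplication turns
  the value \<open>n+1\<close> of \<open>u\<close> into \<open>n+2\<close>, so neither changes whether a position \<open>j \<le> n\<close> is a record.
  Hence \<open>N(n+2,j) = 3 N(n+1,j) - N(n,j)\<close> for \<open>j \<le> n\<close>, the recurrence of every second Fibonacci number,
  and the cases \<open>j = n+1\<close> and \<open>j = n+2\<close> reduce to the number of Boolean permutations.
\<close>

subsection \<open>Fibonacci numbers at integer indices\<close>

lemma fib_int_of_nat: "fib_int (int k) = int (fib k)"
  by (simp add: fib_int_def)

lemma fib_int_uminus_of_nat: "fib_int (- int k) = (-1) ^ (k + 1) * int (fib k)"
  \<comment> \<open>At \<open>k = 0\<close> the definition takes its nonnegative branch, and both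
    sides are 0.\<close>
  by (cases "k = 0") (simp_all add: fib_int_def)

text \<open>The sign split in \<open>fib_int\<close> leaves three situations: all three indices
  nonnegative, all three nonpositive, or \<open>m = -1\<close>, where they are -1, 0, 1 and the
  claim is a computation.\<close>

lemma fib_int_rec: "fib_int (m + 2) = fib_int (m + 1) + fib_int m"
proof -
  consider k where "m = int k" | "m = -1" | k where "m = - int (k + 2)"
  proof (cases "m \<ge> 0")
    case True
    then show ?thesis using that(1)[of "nat m"] by simp
  next
    case False
    then show ?thesis using that(2) that(3)[of "nat (- m - 2)"] by (cases "m = -1") auto
  qed
  then show ?thesis
  proof cases
    case (1 k)
    then have "m + 2 = int (k + 2)" "m + 1 = int (k + 1)" by simp_all
    then show ?thesis unfolding 1 by (simp only: fib_int_of_nat) simp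
  next
    case 2
    then show ?thesis by (simp add: fib_int_def)
  next
    case (3 k)
    then have "m + 2 = - int k" "m + 1 = - int (k + 1)" by simp_all
    then show ?thesis unfolding 3 by (simp only: fib_int_uminus_of_nat) (simp add: algebra_simps)
  qed
qed

text \<open>Eliminating the odd offsets from three consecutive instances of the recurrence leaves a
  relation between indices of equal parity, which is the shape of the counting recurrences.\<close>

lemma fib_int_step2: "fib_int (m + 4) = 3 * fib_int (m + 2) - fib_int m"
  using fib_int_rec[of m] fib_int_rec[of "m + 1"] fib_int_rec[of "m + 2"]
  by (simp add: add.assoc)

subsection \<open>Adding the last generator\<close>

lemma simple_product_Nil [simp]: "simple_product [] = id"
  by (simp add: simple_product_def)

lemma simple_product_Cons [simp]:
  "simple_product (x # xs) = simple_transposition x \<circ> simple_product xs"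
  by (simp add: simple_product_def)

lemma simple_product_append [simp]:
  "simple_product (xs @ ys) = simple_product xs \<circ> simple_product ys"
  by (induction xs) (simp_all add: comp_assoc)

lemma simple_transposition_permutes:
  assumes "1 \<le> i" and "i < n"
  shows "simple_transposition i permutes {1..n}"
  unfolding simple_transposition_def using assms by (intro permutes_swap_id) auto

lemma simple_transposition_simps [simp]:
  "simple_transposition i i = Suc i"
  "simple_transposition i (Suc i) = i"
  "k \<noteq> i \<Longrightarrow> k \<noteq> Suc i \<Longrightarrow> simple_transposition i k = k"
  by (simp_all add: simple_transposition_def)

lemma simple_transposition_involutory [simp]:
  "simple_transposition i (simple_transposition i k) = k"
  by (simp add: simple_transposition_def)

lemma simple_product_permutes:
  assumes "set xs \<subseteq> {1..<n}"
  shows "simple_product xs permutes {1..n}"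
  using assms
proof (induction xs)
  case Nil
  show ?case unfolding simple_product_Nil by (rule permutes_id)
next
  case (Cons x xs)
  then show ?case
    unfolding simple_product_Cons by (intro permutes_compose simple_transposition_permutes) auto
qed

lemma boolean_perms_iff:
  "w \<in> boolean_perms n \<longleftrightarrow> (\<exists>xs. distinct xs \<and> set xs \<subseteq> {1..<n} \<and> w = simple_product xs)"
  unfolding boolean_perms_def using simple_product_permutes by blast

lemma boolean_permsI:
  "distinct xs \<Longrightarrow> set xs \<subseteq> {1..<n} \<Longrightarrow> simple_product xs \<in> boolean_perms n"
  by (auto simp only: boolean_perms_iff)

lemma boolean_permsE:
  assumes "w \<in> boolean_perms n"
  obtains xs where "distinct xs" "set xs \<subseteq> {1..<n}" "w = simple_product xs"
  using assms by (auto simp only: boolean_perms_iff)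

lemma boolean_perms_permutes: "w \<in> boolean_perms n \<Longrightarrow> w permutes {1..n}"
  by (simp add: boolean_perms_def)

lemma finite_boolean_perms: "finite (boolean_perms n)"
proof (rule finite_subset)
  show "boolean_perms n \<subseteq> {w. w permutes {1..n}}" using boolean_perms_permutes by blast
qed (simp add: finite_permutations)

lemma boolean_perms_mono:
  assumes "m \<le> n"
  shows "boolean_perms m \<subseteq> boolean_perms n"
proof
  fix w assume "w \<in> boolean_perms m"
  then obtain xs where "distinct xs" "set xs \<subseteq> {1..<m}" and w: "w = simple_product xs"
    by (rule boolean_permsE)
  moreover have "{1..<m} \<subseteq> {1..<n}" using assms by auto
  ultimately show "w \<in> boolean_perms n" unfolding w by (intro boolean_permsI) auto
qed

lemma boolean_perms_small: "n \<le> 1 \<Longrightarrow> boolean_perms n = {id}"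
  by (auto simp: boolean_perms_iff)

text \<open>The supports are disjoint: \<open>u\<close> moves only points of \<open>{1..n}\<close>,
  and the transposition only n+1 and n+2.\<close>

lemma permutes_commute_simple_transposition:
  assumes "u permutes {1..n}"
  shows "u \<circ> simple_transposition (Suc n) = simple_transposition (Suc n) \<circ> u"
proof
  fix k
  show "(u \<circ> simple_transposition (Suc n)) k = (simple_transposition (Suc n) \<circ> u) k"
  proof (cases "k \<in> {1..n}")
    case True
    then have "u k \<in> {1..n}" using assms by (simp only: permutes_in_image)
    then show ?thesis using True by simp
  next
    case False
    then have "u k = k" using assms by (simp add: permutes_not_in)
    moreover have "simple_transposition (Suc n) k \<notin> {1..n}"
      using False by (cases "k = Suc n"; cases "k = Suc (Suc n)") auto
    ultimately show ?thesis using assms by (simp add: permutes_not_in)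
  qed
qed

text \<open>In a word containing the last generator s, every other generator except the one with
  index \<open>n\<close> commutes with s. That one occurs at most once, so one side of s avoids it,
  and s can be moved across that side to an end of the word.\<close>

lemma boolean_perms_Suc_Suc:
  fixes n :: nat
  defines "s \<equiv> simple_transposition (Suc n)"
  shows "boolean_perms (Suc (Suc n)) =
    boolean_perms (Suc n) \<union> ((\<lambda>u. u \<circ> s) ` boolean_perms (Suc n)
      \<union> (\<lambda>u. s \<circ> u) ` boolean_perms (Suc n))"
    (is "_ = ?B \<union> (?R \<union> ?L)")
proof (intro equalityI subsetI)
  fix w assume "w \<in> boolean_perms (Suc (Suc n))"
  then obtain xs where xs: "distinct xs" "set xs \<subseteq> {1..<Suc (Suc n)}" "w = simple_product xs"
    by (rule boolean_permsE)
  show "w \<in> ?B \<union> (?R \<union> ?L)"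
  proof (cases "Suc n \<in> set xs")
    case False
    then have "set xs \<subseteq> {1..<Suc n}" using xs(2) by (force simp: less_Suc_eq)
    then show ?thesis using xs by (simp add: boolean_permsI)
  next
    case True
    then obtain as bs where split: "xs = as @ Suc n # bs" by (auto simp: in_set_conv_decomp)
    have sub: "set as \<subseteq> {1..<Suc n}" "set bs \<subseteq> {1..<Suc n}"
      using xs(1,2) split by (force simp: less_Suc_eq)+
    have B: "simple_product (as @ bs) \<in> ?B"
      using xs(1) split sub by (intro boolean_permsI) auto
    \<comment> \<open>Distinctness of the word keeps index \<open>n\<close> out of at least one of
      the two sides.\<close>
    consider "n \<notin> set as" | "n \<notin> set bs" using xs(1) split by auto
    then show ?thesis
    proof cases
      case 1
      then have "set as \<subseteq> {1..<n}" using sub by (force simp: less_Suc_eq)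
      then have "simple_product as \<circ> s = s \<circ> simple_product as"
        unfolding s_def by (intro permutes_commute_simple_transposition simple_product_permutes)
      then have "w = s \<circ> simple_product (as @ bs)"
        using xs(3) split by (simp add: s_def flip: comp_assoc)
      then show ?thesis using B by blast
    next
      case 2
      then have "set bs \<subseteq> {1..<n}" using sub by (force simp: less_Suc_eq)
      then have "simple_product bs \<circ> s = s \<circ> simple_product bs"
        unfolding s_def by (intro permutes_commute_simple_transposition simple_product_permutes)
      then have "w = simple_product (as @ bs) \<circ> s"
        using xs(3) split by (simp add: s_def comp_assoc)
      then show ?thesis using B by blast
    qed
  qed
next
  fix w assume w: "w \<in> ?B \<union> (?R \<union> ?L)"
  have "u \<circ> s \<in> boolean_perms (Suc (Suc n)) \<and> s \<circ> u \<in> boolean_perms (Suc (Suc n))"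
    if u: "u \<in> ?B" for u
  proof -
    obtain xs where xs: "distinct xs" "set xs \<subseteq> {1..<Suc n}" "u = simple_product xs"
      using u by (rule boolean_permsE)
    have "distinct (xs @ [Suc n])" "set (xs @ [Suc n]) \<subseteq> {1..<Suc (Suc n)}"
      "distinct (Suc n # xs)" "set (Suc n # xs) \<subseteq> {1..<Suc (Suc n)}"
      using xs(1,2) by auto
    moreover have "u \<circ> s = simple_product (xs @ [Suc n])" "s \<circ> u = simple_product (Suc n # xs)"
      by (simp_all add: xs(3) s_def)
    ultimately show ?thesis by (metis boolean_permsI)
  qed
  then show "w \<in> boolean_perms (Suc (Suc n))"
    using w boolean_perms_mono[of "Suc n" "Suc (Suc n)"] by auto
qed

text \<open>If the generator with index \<open>n\<close> is placed at an end of the word, the image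
  of n+1 becomes \<open>u n\<close> or \<open>n\<close>, and neither equals n+1. A permutation
  fixing n+1 must then come from the remaining piece of the decomposition.\<close>

lemma boolean_perms_Suc_fixpoint:
  assumes "w \<in> boolean_perms (Suc n)" and "w (Suc n) = Suc n"
  shows "w \<in> boolean_perms n"
proof (cases n)
  case 0
  then show ?thesis using assms(1) by (simp add: boolean_perms_small)
next
  case (Suc m)
  have last: "u (Suc n) = Suc n" "u n \<noteq> Suc n" if "u \<in> boolean_perms n" for u
    using boolean_perms_permutes[OF that] permutes_not_in[of u "{1..n}" "Suc n"]
      permutes_in_image[of u "{1..n}" n] Suc by auto
  have "w \<noteq> u \<circ> simple_transposition n" "w \<noteq> simple_transposition n \<circ> u"
    if "u \<in> boolean_perms n" for u
    using last[OF that] assms(2) by auto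
  then show ?thesis using assms(1) boolean_perms_Suc_Suc[of m] unfolding Suc by blast
qed

text \<open>Inclusion-exclusion over the three pieces of the decomposition. The predicate
  \<open>P\<close> is kept arbitrary so that one count serves both for the size of
  \<open>boolean_perms\<close> and for records at any position.\<close>

lemma card_boolean_perms_Suc_Suc:
  fixes n :: nat and P :: "(nat \<Rightarrow> nat) \<Rightarrow> bool"
  defines "s \<equiv> simple_transposition (Suc n)"
  shows "card {w \<in> boolean_perms (Suc (Suc n)). P w} + card {u \<in> boolean_perms n. P (u \<circ> s)} =
    card {u \<in> boolean_perms (Suc n). P u} + card {u \<in> boolean_perms (Suc n). P (u \<circ> s)}
      + card {u \<in> boolean_perms (Suc n). P (s \<circ> u)}"
proof -
  let ?B = "boolean_perms (Suc n)"
  define A where "A = {u \<in> ?B. P u}"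
  define R where "R = (\<lambda>u. u \<circ> s) ` {u \<in> ?B. P (u \<circ> s)}"
  define L where "L = (\<lambda>u. s \<circ> u) ` {u \<in> ?B. P (s \<circ> u)}"
  have ss: "s \<circ> s = id" by (auto simp: s_def)
  have injR: "inj (\<lambda>u :: nat \<Rightarrow> nat. u \<circ> s)"
    by (rule inj_on_inverseI[where g = "\<lambda>u. u \<circ> s"]) (simp add: comp_assoc ss)
  have injL: "inj (\<lambda>u :: nat \<Rightarrow> nat. s \<circ> u)"
    by (rule inj_on_inverseI[where g = "\<lambda>u. s \<circ> u"]) (simp add: ss flip: comp_assoc)
  have fin: "finite A" "finite R" "finite L"
    unfolding A_def R_def L_def using finite_boolean_perms by auto
  have last: "u (Suc (Suc n)) = Suc (Suc n)" "u (Suc n) \<noteq> Suc (Suc n)" if "u \<in> ?B" for u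
    using boolean_perms_permutes[OF that] permutes_not_in[of u "{1..Suc n}" "Suc (Suc n)"]
      permutes_in_image[of u "{1..Suc n}" "Suc n"] by auto
  have un: "{w \<in> boolean_perms (Suc (Suc n)). P w} = A \<union> (R \<union> L)"
    unfolding boolean_perms_Suc_Suc A_def R_def L_def s_def by blast
  \<comment> \<open>The point n+2 separates the pieces: it is fixed by elements of \<open>A\<close>
    and moved by those of \<open>R\<close> and \<open>L\<close>.\<close>
  have disj: "A \<inter> (R \<union> L) = {}"
  proof -
    have "w (Suc (Suc n)) \<noteq> Suc (Suc n)" if "w \<in> R \<union> L" for w
    proof
      assume fixed: "w (Suc (Suc n)) = Suc (Suc n)"
      consider u where "u \<in> ?B" "w = u \<circ> s" | u where "u \<in> ?B" "w = s \<circ> u"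
        using \<open>w \<in> R \<union> L\<close> unfolding R_def L_def by blast
      then show False
      proof cases
        case (1 u)
        then show ?thesis using fixed last(2)[of u] by (simp add: s_def)
      next
        case (2 u)
        then show ?thesis using fixed last(1)[of u] by (simp add: s_def)
      qed
    qed
    moreover have "w (Suc (Suc n)) = Suc (Suc n)" if "w \<in> A" for w
      using that last unfolding A_def by auto
    ultimately show ?thesis by blast
  qed
  \<comment> \<open>Evaluating \<open>u \<circ> s = s \<circ> v\<close> at n+2 shows that
    \<open>u\<close> fixes n+1, so \<open>u\<close> already lies in
    \<open>boolean_perms n\<close>.\<close>
  have inter: "R \<inter> L = (\<lambda>u. u \<circ> s) ` {u \<in> boolean_perms n. P (u \<circ> s)}"
  proof (intro equalityI subsetI)
    fix w assume "w \<in> R \<inter> L"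
    then obtain u v where uv: "u \<in> ?B" "P (u \<circ> s)" "w = u \<circ> s" "v \<in> ?B" "w = s \<circ> v"
      unfolding R_def L_def by blast
    have "u (Suc n) = w (Suc (Suc n))" unfolding uv(3) by (simp add: s_def)
    also have "\<dots> = Suc n" unfolding uv(5) using last[OF uv(4)] by (simp add: s_def)
    finally have "u \<in> boolean_perms n" using uv(1) by (rule boolean_perms_Suc_fixpoint[rotated])
    then show "w \<in> (\<lambda>u. u \<circ> s) ` {u \<in> boolean_perms n. P (u \<circ> s)}" using uv by blast
  next
    fix w assume "w \<in> (\<lambda>u. u \<circ> s) ` {u \<in> boolean_perms n. P (u \<circ> s)}"
    then obtain u where u: "u \<in> boolean_perms n" "P (u \<circ> s)" "w = u \<circ> s" by blast
    have "u \<circ> s = s \<circ> u"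
      unfolding s_def by (rule permutes_commute_simple_transposition[OF boolean_perms_permutes[OF u(1)]])
    moreover have "u \<in> ?B" using u(1) boolean_perms_mono[of n "Suc n"] by auto
    ultimately have "w \<in> R" "w \<in> L"
      unfolding R_def L_def using u by (intro image_eqI[of _ _ u]; simp)+
    then show "w \<in> R \<inter> L" by blast
  qed
  have "card (A \<union> (R \<union> L)) + card (R \<inter> L) = card A + card R + card L"
    using card_Un_disjoint[OF fin(1) _ disj] card_Un_Int[OF fin(2,3)] fin by simp
  moreover have "card R = card {u \<in> ?B. P (u \<circ> s)}"
    unfolding R_def by (rule card_image[OF inj_on_subset[OF injR]]) simp
  moreover have "card L = card {u \<in> ?B. P (s \<circ> u)}"
    unfolding L_def by (rule card_image[OF inj_on_subset[OF injL]]) simp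
  moreover have "card (R \<inter> L) = card {u \<in> boolean_perms n. P (u \<circ> s)}"
    unfolding inter by (rule card_image[OF inj_on_subset[OF injR]]) simp
  ultimately show ?thesis unfolding un A_def by simp
qed

lemma card_boolean_perms: "int (card (boolean_perms n)) = fib_int (2 * int n - 1)"
\<comment> \<open>This rule supplies the two-step induction. Its base cases hold because
  \<open>fib_int\<close> is 1 at both -1 and 1.\<close>
proof (induction n rule: fib.induct)
  case 1
  show ?case by (simp add: boolean_perms_small fib_int_def)
next
  case 2
  show ?case by (simp add: boolean_perms_small fib_int_def)
next
  case (3 n)
  have "card (boolean_perms (Suc (Suc n))) + card (boolean_perms n) = 3 * card (boolean_perms (Suc n))"
    using card_boolean_perms_Suc_Suc[of n "\<lambda>_. True"] by simp
  then show ?case using 3 fib_int_step2[of "2 * int n - 1"] by (simp add: algebra_simps)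
qed

subsection \<open>Records\<close>

lemma is_record_comp_simple_transposition:
  assumes "j < i"
  shows "is_record (u \<circ> simple_transposition i) j \<longleftrightarrow> is_record u j"
  using assms unfolding is_record_def by auto

text \<open>On the values \<open>{1..m}\<close> of \<open>u\<close> the transposition only raises m
  to m+1, so it is strictly increasing there and preserves every comparison.\<close>

lemma is_record_simple_transposition_comp:
  assumes u: "u permutes {1..m}" and j: "1 \<le> j" "j \<le> m"
  shows "is_record (simple_transposition m \<circ> u) j \<longleftrightarrow> is_record u j"
proof -
  have "simple_transposition m (u k) > simple_transposition m (u j) \<longleftrightarrow> u k > u j"
    if "1 \<le> k" "k < j" for k
  proof -
    have "u k \<le> m" "u j \<le> m"
      using permutes_in_image[OF u, of k] permutes_in_image[OF u, of j] that j by auto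
    then show ?thesis by (cases "u k = m"; cases "u j = m") auto
  qed
  then show ?thesis unfolding is_record_def by auto
qed

text \<open>The product takes the value m+1 at position m, which exceeds all values at earlier
  positions.\<close>

lemma is_record_comp_simple_transposition_self:
  assumes "u permutes {1..m}"
  shows "is_record (u \<circ> simple_transposition m) m"
proof -
  have "u k \<le> Suc m" if "1 \<le> k" "k < m" for k
    using permutes_in_image[OF assms, of k] that by auto
  moreover have "u (Suc m) = Suc m" using assms by (simp add: permutes_not_in)
  ultimately have "\<not> (u \<circ> simple_transposition m) k > (u \<circ> simple_transposition m) m"
    if "1 \<le> k" "k < m" for k
    using that by (simp add: not_less)
  then show ?thesis unfolding is_record_def by blast
qed

lemma is_record_last_iff:
  assumes u: "u permutes {1..n}" and n: "n \<ge> 1"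
  shows "is_record u n \<longleftrightarrow> u n = n"
proof
  assume rec: "is_record u n"
  obtain k where k: "u k = n" using permutes_surj[OF u] by (metis surjD)
  have "k \<in> {1..n}" using permutes_in_image[OF u, of k] k n by simp
  moreover have "u n \<le> n" using permutes_in_image[OF u, of n] n by simp
  ultimately show "u n = n"
    using rec k unfolding is_record_def by (cases "k = n") (auto simp: not_less)
next
  assume "u n = n"
  then have "\<not> u k > u n" if "1 \<le> k" "k < n" for k
    using permutes_in_image[OF u, of k] that by simp
  then show "is_record u n" unfolding is_record_def by blast
qed

section \<open>Boundary values and recurrence of the record counts\<close>

lemma num_boolean_records_last: "num_boolean_records (Suc n) (Suc n) = card (boolean_perms n)"
proof -
  have "w \<in> boolean_perms (Suc n) \<and> is_record w (Suc n) \<longleftrightarrow> w \<in> boolean_perms n" for w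
  proof
    \<comment> \<open>A record at the last position holds the largest value, so it is a fixed point
      and the last generator drops out.\<close>
    assume "w \<in> boolean_perms (Suc n) \<and> is_record w (Suc n)"
    then show "w \<in> boolean_perms n"
      using is_record_last_iff[of w "Suc n"] boolean_perms_permutes boolean_perms_Suc_fixpoint
      by auto
  next
    assume w: "w \<in> boolean_perms n"
    then have "w (Suc n) = Suc n" using boolean_perms_permutes by (fastforce intro: permutes_not_in)
    moreover have "w \<in> boolean_perms (Suc n)" using w boolean_perms_mono[of n "Suc n"] by auto
    ultimately show "w \<in> boolean_perms (Suc n) \<and> is_record w (Suc n)"
      using is_record_last_iff[of w "Suc n"] boolean_perms_permutes by auto
  qed
  then show ?thesis unfolding num_boolean_records_def by simp
qed

text \<open>At this position right multiplication by the last generator always creates a record, so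
  the two corresponding terms of the general count become full cardinalities. Left multiplication
  still preserves records, which gives the factor 2.\<close>

lemma num_boolean_records_penultimate:
  "num_boolean_records (Suc (Suc n)) (Suc n) + card (boolean_perms n) =
     2 * num_boolean_records (Suc n) (Suc n) + card (boolean_perms (Suc n))"
proof -
  let ?s = "simple_transposition (Suc n)"
  have "is_record (u \<circ> ?s) (Suc n)" if "u \<in> boolean_perms (Suc n)" for u
    using is_record_comp_simple_transposition_self[OF boolean_perms_permutes[OF that]] .
  moreover have "is_record (?s \<circ> u) (Suc n) \<longleftrightarrow> is_record u (Suc n)"
    if "u \<in> boolean_perms (Suc n)" for u
    using is_record_simple_transposition_comp[OF boolean_perms_permutes[OF that]] by simp
  moreover have "boolean_perms n \<subseteq> boolean_perms (Suc n)" by (rule boolean_perms_mono) simp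
  ultimately have
    "{u \<in> boolean_perms n. is_record (u \<circ> ?s) (Suc n)} = boolean_perms n"
    "{u \<in> boolean_perms (Suc n). is_record (u \<circ> ?s) (Suc n)} = boolean_perms (Suc n)"
    "{u \<in> boolean_perms (Suc n). is_record (?s \<circ> u) (Suc n)} =
       {u \<in> boolean_perms (Suc n). is_record u (Suc n)}"
    by blast+
  then show ?thesis
    using card_boolean_perms_Suc_Suc[of n "\<lambda>w. is_record w (Suc n)"]
    unfolding num_boolean_records_def by simp
qed

lemma num_boolean_records_Suc_Suc:
  assumes "1 \<le> j" and "j \<le> n"
  shows "num_boolean_records (Suc (Suc n)) j + num_boolean_records n j =
    3 * num_boolean_records (Suc n) j"
proof -
  let ?s = "simple_transposition (Suc n)"
  have "is_record (u \<circ> ?s) j \<longleftrightarrow> is_record u j" for u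
    using assms by (intro is_record_comp_simple_transposition) simp
  moreover have "is_record (?s \<circ> u) j \<longleftrightarrow> is_record u j" if "u \<in> boolean_perms (Suc n)" for u
    using is_record_simple_transposition_comp[OF boolean_perms_permutes[OF that]] assms by simp
  then have "{u \<in> boolean_perms (Suc n). is_record (?s \<circ> u) j} =
      {u \<in> boolean_perms (Suc n). is_record u j}" by blast
  ultimately show ?thesis
    using card_boolean_perms_Suc_Suc[of n "\<lambda>w. is_record w j"]
    unfolding num_boolean_records_def by simp
qed

text \<open>Writing j = i+1 and n = j+k avoids natural subtraction and fixes the position while
  \<open>k\<close> grows, so the three-term recurrence becomes a two-step induction on
  \<open>k\<close>.\<close>

lemma num_boolean_records_add:
  "int (num_boolean_records (Suc i + k) (Suc i)) =
    fib_int (2 * int (i + k)) - fib_int (2 * int i - 2) * fib_int (2 * int k - 1)"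
proof (induction k rule: fib.induct)
  case 1
  \<comment> \<open>For k = 0 the claim reduces to F_{2i-1} = F_{2i} - F_{2i-2}.\<close>
  have "fib_int (-1) = 1" by (simp add: fib_int_def)
  then show ?case
    using num_boolean_records_last[of i] card_boolean_perms[of i] fib_int_rec[of "2 * int i - 2"]
    by simp
next
  case 2
  \<comment> \<open>For k = 1 the count is F_{2i-1} + F_{2i+1}, to be matched with F_{2i+2} -
    F_{2i-2}.\<close>
  have "fib_int 1 = 1" by (simp add: fib_int_def)
  then show ?case
    using num_boolean_records_penultimate[of i] num_boolean_records_last[of i]
      card_boolean_perms[of i] card_boolean_perms[of "Suc i"]
      fib_int_rec[of "2 * int i - 2"] fib_int_rec[of "2 * int i - 1"] fib_int_rec[of "2 * int i"]
    by (simp add: algebra_simps)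
next
  case (3 k)
  have "num_boolean_records (Suc i + Suc (Suc k)) (Suc i) + num_boolean_records (Suc i + k) (Suc i) =
      3 * num_boolean_records (Suc i + Suc k) (Suc i)"
    using num_boolean_records_Suc_Suc[of "Suc i" "Suc i + k"] by simp
  then have "int (num_boolean_records (Suc i + Suc (Suc k)) (Suc i)) =
      3 * int (num_boolean_records (Suc i + Suc k) (Suc i))
        - int (num_boolean_records (Suc i + k) (Suc i))"
    by linarith
  \<comment> \<open>The factor F_{2i-2} is constant in \<open>k\<close>, so the recurrence for every
    second index applies to each of the two terms separately.\<close>
  also have "\<dots> = (3 * fib_int (2 * int (i + k) + 2) - fib_int (2 * int (i + k)))
      - fib_int (2 * int i - 2) * (3 * fib_int (2 * int k - 1 + 2) - fib_int (2 * int k - 1))"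
    unfolding 3 by (simp add: algebra_simps)
  also have "\<dots> = fib_int (2 * int (i + k) + 4)
      - fib_int (2 * int i - 2) * fib_int (2 * int k - 1 + 4)"
    unfolding fib_int_step2 ..
  finally show ?case by (simp add: algebra_simps)
qed

theorem theorem5p10:
  fixes n j :: nat
  assumes "n \<ge> 1" and "1 \<le> j" and "j \<le> n"
  shows "int (num_boolean_records n j) =
    fib_int (2 * int n - 2) - fib_int (2 * int j - 4) * fib_int (2 * (int n - int j) - 1)"
proof -
  obtain i where "j = Suc i" using assms(2) by (cases j) auto
  moreover obtain k where "n = j + k" using assms(3) le_Suc_ex by blast
  ultimately show ?thesis using num_boolean_records_add[of i k] by (simp add: algebra_simps)
qed

end
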